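(* Let $\mathfrak S \subseteq \mathrm{Vir}$ be a subspace of codimension $1$. Then $\mathfrak S$ is a Lie subalgebra of $\mathrm{Vir}$ if and only if there exists $c \in \mathbb{C}^\times$ such that $\mathfrak S = \mathrm{span}_{\mathbb{C}} \{ z,\ e_j + c\, e_{j + 1} \mid j \in \mathbb{Z} \}$.
   Context: $\mathbb{C}^\times=\mathbb{C}\setminus\{0\}$. The Virasoro algebra $\mathrm{Vir}$ is the complex Lie algebra with basis $\{z\}\cup\{e_j \mid j\in\mathbb{Z}\}$ and bracket $[e_j,e_k]=(k-j)e_{j+k}+\delta_{k,-j}\frac{j^3-j}{12}z$, $[z,e_j]=0$. *)

theory Defs
  imports Complex_Main "HOL-Library.Poly_Mapping"
begin

text \<open>
  The Virasoro algebra as the free complex vector space on the symbols \<open>z\<close> and \<open>e\<^sub>j\<close>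
  (finitely supported coefficient functions), so that these symbols form a basis by construction.
\<close>

datatype vir_index = Cent | Gen int

type_synonym vir = "vir_index \<Rightarrow>\<^sub>0 complex"

definition vir_z :: vir where
  "vir_z = Poly_Mapping.single Cent 1"

definition vir_e :: "int \<Rightarrow> vir" where
  "vir_e j = Poly_Mapping.single (Gen j) 1"

definition vir_scale :: "complex \<Rightarrow> vir \<Rightarrow> vir" (infixr "*\<^sub>V" 75) where
  "c *\<^sub>V x = Poly_Mapping.map ((*) c) x"

lemma lookup_vir_scale [simp]:
  "Poly_Mapping.lookup (c *\<^sub>V x) i = c * Poly_Mapping.lookup x i"
  by (simp add: vir_scale_def map.rep_eq when_def)

global_interpretation vir: vector_space vir_scale
  by unfold_locales (auto intro!: poly_mapping_eqI simp: lookup_add algebra_simps)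

fun basis_bracket :: "vir_index \<Rightarrow> vir_index \<Rightarrow> vir" where
  "basis_bracket (Gen j) (Gen k) =
     of_int (k - j) *\<^sub>V vir_e (j + k)
     + (if k = - j then (of_int (j ^ 3 - j) / 12) *\<^sub>V vir_z else 0)"
| "basis_bracket Cent _ = 0"
| "basis_bracket _ Cent = 0"

text \<open>The bracket is the bilinear extension of \<^const>\<open>basis_bracket\<close>.\<close>

definition vir_bracket :: "vir \<Rightarrow> vir \<Rightarrow> vir" where
  "vir_bracket x y =
     (\<Sum>a\<in>Poly_Mapping.keys x. \<Sum>b\<in>Poly_Mapping.keys y.
        (Poly_Mapping.lookup x a * Poly_Mapping.lookup y b) *\<^sub>V basis_bracket a b)"

lemma vir_bracket_e_e:
  "vir_bracket (vir_e j) (vir_e k) =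
     of_int (k - j) *\<^sub>V vir_e (j + k)
     + (if k = - j then (of_int (j ^ 3 - j) / 12) *\<^sub>V vir_z else 0)"
  by (simp add: vir_bracket_def vir_e_def)

lemma vir_bracket_z_left: "vir_bracket vir_z x = 0"
  by (simp add: vir_bracket_def vir_z_def)

definition lie_subalgebra :: "vir set \<Rightarrow> bool" where
  "lie_subalgebra S \<longleftrightarrow> vir.subspace S \<and> (\<forall>x\<in>S. \<forall>y\<in>S. vir_bracket x y \<in> S)"

text \<open>
  A subspace \<open>S\<close> of \<open>V\<close> has codimension \<open>n\<close> if \<open>dim (V / S) = n\<close>, i.e. if there are \<open>n\<close> vectors
  whose cosets form a basis of \<open>V / S\<close>: every coset is a linear combination of theirs with
  unique coefficients.  This is spelled out because \<^term>\<open>vir.dim\<close> measures only subsets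
  of the ambient space, not quotients.
\<close>

definition coset :: "vir set \<Rightarrow> vir \<Rightarrow> vir set" where
  "coset S v = {v + s | s. s \<in> S}"

definition has_codim :: "vir set \<Rightarrow> nat \<Rightarrow> bool" where
  "has_codim S n \<longleftrightarrow> vir.subspace S \<and>
     (\<exists>B. finite B \<and> card B = n \<and>
        (\<forall>v. \<exists>!f. (\<forall>b. b \<notin> B \<longrightarrow> f b = 0) \<and>
                 coset S v = coset S (\<Sum>b\<in>B. f b *\<^sub>V b)))"

end

theory Submission imports Defs begin

text \<open>
  Write \<open>S\<close> as the kernel of a linear functional \<open>\<phi>\<close>.  If \<open>S\<close> is a subalgebra, then
  \<open>\<phi> w \<phi> [x, y] = \<phi> y \<phi> [x, w] + \<phi> x \<phi> [w, y]\<close> whenever \<open>\<phi> w \<noteq> 0\<close>.  For \<open>w = z\<close> this would make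
  \<open>\<phi>\<close> vanish on \<open>[Vir, Vir] = Vir\<close>, so \<open>\<phi> z = 0\<close>.  Put \<open>a\<^sub>j = \<phi> e\<^sub>j\<close>.  If \<open>a\<^sub>0 = 0\<close>, the identity
  allows at most one nonzero \<open>a\<^sub>m\<close>, and \<open>[e\<^sub>2\<^sub>m, e\<^sub>-\<^sub>m] = -3m e\<^sub>m\<close> excludes that one too.  Hence
  \<open>a\<^sub>0 \<noteq> 0\<close>, and \<open>w = e\<^sub>0\<close> gives \<open>a\<^sub>0 a\<^bsub>j+k\<^esub> = a\<^sub>j a\<^sub>k\<close> for \<open>j \<noteq> k\<close>, which forces \<open>a\<close> to be a geometric
  progression with nonzero ratio.
\<close>

section \<open>Bilinearity and antisymmetry of the bracket\<close>

lemma vir_bracket_superset: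
  assumes "finite A" "Poly_Mapping.keys x \<subseteq> A" "finite B" "Poly_Mapping.keys y \<subseteq> B"
  shows "vir_bracket x y =
    (\<Sum>a\<in>A. \<Sum>b\<in>B. (Poly_Mapping.lookup x a * Poly_Mapping.lookup y b) *\<^sub>V basis_bracket a b)"
proof -
  have "vir_bracket x y = (\<Sum>a\<in>Poly_Mapping.keys x. \<Sum>b\<in>B.
      (Poly_Mapping.lookup x a * Poly_Mapping.lookup y b) *\<^sub>V basis_bracket a b)"
    unfolding vir_bracket_def using assms
    by (intro sum.cong refl sum.mono_neutral_left) (auto simp: in_keys_iff)
  also have "\<dots> = (\<Sum>a\<in>A. \<Sum>b\<in>B.
      (Poly_Mapping.lookup x a * Poly_Mapping.lookup y b) *\<^sub>V basis_bracket a b)"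
    using assms by (intro sum.mono_neutral_left) (auto simp: in_keys_iff)
  finally show ?thesis .
qed

lemma vir_bracket_add_left: "vir_bracket (x + x') y = vir_bracket x y + vir_bracket x' y"
proof -
  \<comment> \<open>The keys of \<open>x\<close>, \<open>x'\<close> and \<open>x + x'\<close> may
    differ. Over a common index set, padded with zero terms, the double sums add termwise.\<close>
  let ?A = "Poly_Mapping.keys x \<union> Poly_Mapping.keys x'"
  have "vir_bracket u y = (\<Sum>a\<in>?A. \<Sum>b\<in>Poly_Mapping.keys y.
      (Poly_Mapping.lookup u a * Poly_Mapping.lookup y b) *\<^sub>V basis_bracket a b)"
    if "Poly_Mapping.keys u \<subseteq> ?A" for u
    using that by (intro vir_bracket_superset) auto
  from this[of x] this[of x'] this[of "x + x'"] show ?thesis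
    by (simp add: Poly_Mapping.keys_add lookup_add distrib_right vir.scale_left_distrib sum.distrib)
qed

lemma vir_bracket_scale_left: "vir_bracket (c *\<^sub>V x) y = c *\<^sub>V vir_bracket x y"
proof -
  have "vir_bracket (c *\<^sub>V x) y = (\<Sum>a\<in>Poly_Mapping.keys x. \<Sum>b\<in>Poly_Mapping.keys y.
      (Poly_Mapping.lookup (c *\<^sub>V x) a * Poly_Mapping.lookup y b) *\<^sub>V basis_bracket a b)"
    by (intro vir_bracket_superset) (auto simp: in_keys_iff)
  then show ?thesis
    by (simp add: vir_bracket_def vir.scale_sum_right mult.assoc)
qed

lemma basis_bracket_antisym: "basis_bracket a b = - basis_bracket b a"
proof (cases a; cases b)
  fix j k assume [simp]: "a = Gen j" "b = Gen k"
  show ?thesis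
    by (auto simp: add.commute[of j k] minus_divide_left simp flip: vir.scale_minus_left)
qed auto

lemma vir_bracket_antisym: "vir_bracket x y = - vir_bracket y x"
proof -
  have "vir_bracket x y = (\<Sum>a\<in>Poly_Mapping.keys x. \<Sum>b\<in>Poly_Mapping.keys y.
      - ((Poly_Mapping.lookup y b * Poly_Mapping.lookup x a) *\<^sub>V basis_bracket b a))"
    unfolding vir_bracket_def
    by (intro sum.cong refl) (metis basis_bracket_antisym mult.commute vir.scale_minus_right)
  also have "\<dots> = - vir_bracket y x"
    unfolding vir_bracket_def by (subst sum.swap) (simp add: sum_negf)
  finally show ?thesis .
qed

lemma vir_bracket_self: "vir_bracket x x = 0"
proof (rule poly_mapping_eqI)
  fix i
  have "Poly_Mapping.lookup (vir_bracket x x) i = - Poly_Mapping.lookup (vir_bracket x x) i"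
    by (metis vir_bracket_antisym lookup_uminus uminus_apply)
  then show "Poly_Mapping.lookup (vir_bracket x x) i = Poly_Mapping.lookup 0 i"
    by simp
qed

lemma vir_bracket_add_right: "vir_bracket x (y + y') = vir_bracket x y + vir_bracket x y'"
  by (metis vir_bracket_antisym vir_bracket_add_left minus_add_distrib)

lemma vir_bracket_scale_right: "vir_bracket x (c *\<^sub>V y) = c *\<^sub>V vir_bracket x y"
  by (metis vir_bracket_antisym vir_bracket_scale_left vir.scale_minus_right)

lemma vir_bracket_z_right: "vir_bracket x vir_z = 0"
  by (metis vir_bracket_antisym vir_bracket_z_left neg_0_equal_iff_equal)

lemma vir_bracket_zero_left: "vir_bracket 0 y = 0"
  by (simp add: vir_bracket_def)

lemma vir_bracket_zero_right: "vir_bracket x 0 = 0"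
  by (simp add: vir_bracket_def)

text \<open>Bilinearity reduces closure to generators: the induction runs first over
  \<open>x\<close> against a fixed generator, then over \<open>y\<close>.\<close>

lemma vir_bracket_span_closed:
  assumes gen: "\<And>x y. x \<in> G \<Longrightarrow> y \<in> G \<Longrightarrow> vir_bracket x y \<in> vir.span G"
    and x: "x \<in> vir.span G" and y: "y \<in> vir.span G"
  shows "vir_bracket x y \<in> vir.span G"
proof -
  have "vir_bracket x v \<in> vir.span G" if "v \<in> G" for v
    using x
  proof (induction rule: vir.span_induct)
    case base
    show ?case
      by (rule vir.subspaceI)
        (auto simp: vir_bracket_zero_left vir_bracket_add_left vir_bracket_scale_left
          vir.span_zero intro: vir.span_add vir.span_scale)
  qed (use gen that in blast)
  note * = this
  show ?thesis
    using y
  proof (induction rule: vir.span_induct)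
    case base
    show ?case
      by (rule vir.subspaceI)
        (auto simp: vir_bracket_zero_right vir_bracket_add_right vir_bracket_scale_right
          vir.span_zero intro: vir.span_add vir.span_scale)
  qed (use * in blast)
qed

lemma vir_span_basis: "vir.span ({vir_z} \<union> range vir_e) = UNIV"
proof -
  have "x \<in> vir.span ({vir_z} \<union> range vir_e)" for x
  proof -
    have single: "Poly_Mapping.single i 1 \<in> {vir_z} \<union> range vir_e" for i
      by (cases i) (auto simp: vir_z_def vir_e_def)
    have "x = (\<Sum>i\<in>Poly_Mapping.keys x. Poly_Mapping.lookup x i *\<^sub>V Poly_Mapping.single i 1)"
      by (rule poly_mapping_eqI)
        (auto simp: lookup_sum lookup_single when_def in_keys_iff if_distrib cong: if_cong)
    then show ?thesis
      by (metis (no_types, lifting) single vir.span_sum vir.span_scale vir.span_base)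
  qed
  then show ?thesis by blast
qed

section \<open>Subspaces of codimension one as kernels of functionals\<close>

lemma functional_of_codim_1:
  assumes "has_codim S 1"
  obtains \<phi> where "Vector_Spaces.linear vir_scale ((*) :: complex \<Rightarrow> _) \<phi>"
    and "\<And>v. v \<in> S \<longleftrightarrow> \<phi> v = 0" and "\<exists>v. \<phi> v \<noteq> 0"
proof -
  have S: "vir.subspace S" using assms by (simp add: has_codim_def)
  from assms obtain B where "card B = 1"
    and B: "\<forall>v. \<exists>!f. (\<forall>b. b \<notin> B \<longrightarrow> f b = 0) \<and> coset S v = coset S (\<Sum>b\<in>B. f b *\<^sub>V b)"
    unfolding has_codim_def by blast
  then obtain b where b: "B = {b}"
    by (elim card_1_singletonE)
  have ex1: "\<exists>!f. (\<forall>b'. b' \<notin> {b} \<longrightarrow> f b' = 0) \<and>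
      coset S v = coset S (\<Sum>b'\<in>{b}. f b' *\<^sub>V b')" for v
    using B unfolding b by (rule spec)
  have coset_eq: "coset S u = coset S v \<longleftrightarrow> u - v \<in> S" for u v
  proof
    assume "coset S u = coset S v"
    moreover have "u \<in> coset S u"
      using vir.subspace_0[OF S] by (force simp: coset_def)
    ultimately show "u - v \<in> S" by (auto simp: coset_def)
  next
    assume uv: "u - v \<in> S"
    have "\<exists>s'. u + s = v + s' \<and> s' \<in> S" if "s \<in> S" for s
      using vir.subspace_add[OF S uv that] by (intro exI[of _ "u - v + s"]) auto
    moreover have "\<exists>s'. v + s = u + s' \<and> s' \<in> S" if "s \<in> S" for s
      using vir.subspace_diff[OF S that uv] by (intro exI[of _ "s - (u - v)"]) auto
    ultimately show "coset S u = coset S v" unfolding coset_def by blast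
  qed
  have ex: "\<exists>c. v - c *\<^sub>V b \<in> S" for v
  proof -
    from ex1[of v] obtain f :: "vir \<Rightarrow> complex" where "coset S v = coset S (\<Sum>b'\<in>{b}. f b' *\<^sub>V b')"
      by (elim ex1E conjE)
    then show ?thesis by (auto simp: coset_eq)
  qed
  have "b \<notin> S"
  proof
    assume b: "b \<in> S"
    \<comment> \<open>With \<open>b\<close> in \<open>S\<close>, the coefficients 0 and 1 at
      \<open>b\<close> would both represent the zero coset, against uniqueness.\<close>
    have "(\<lambda>_. 0) = (\<lambda>_. 0)(b := 1 :: complex)"
      by (rule Uniq_D[OF ex1_iff_ex_Uniq[THEN iffD1, OF ex1[of 0], THEN conjunct2]])
        (use vir.subspace_0[OF S] vir.subspace_neg[OF S b] in \<open>simp_all add: coset_eq\<close>)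
    then show False by (metis fun_upd_same zero_neq_one)
  qed
  then have uniq: "c = 0" if "c *\<^sub>V b \<in> S" for c
    using vir.subspace_scale[OF S that, of "inverse c"] by (cases "c = 0") auto
  \<comment> \<open>\<open>\<phi> v\<close> is the coordinate of the coset of \<open>v\<close> with
    respect to that of \<open>b\<close>. It exists by \<open>ex\<close>; \<open>uniq\<close> yields
    \<open>eqI\<close>, by which linearity only needs a candidate value to be checked.\<close>
  define \<phi> where "\<phi> v = (SOME c. v - c *\<^sub>V b \<in> S)" for v
  have \<phi>: "v - \<phi> v *\<^sub>V b \<in> S" for v
    unfolding \<phi>_def by (rule someI_ex[OF ex])
  have eqI: "\<phi> v = c" if "v - c *\<^sub>V b \<in> S" for v c
    using uniq[of "c - \<phi> v"] vir.subspace_diff[OF S \<phi>[of v] that]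
    by (simp add: vir.scale_left_diff_distrib)
  show ?thesis
  proof
    show "Vector_Spaces.linear vir_scale ((*) :: complex \<Rightarrow> _) \<phi>"
    proof unfold_locales
      fix x y c
      show "\<phi> (x + y) = \<phi> x + \<phi> y"
        using vir.subspace_add[OF S \<phi>[of x] \<phi>[of y]]
        by (intro eqI) (simp add: vir.scale_left_distrib algebra_simps)
      show "\<phi> (c *\<^sub>V x) = c * \<phi> x"
        using vir.subspace_scale[OF S \<phi>[of x], of c]
        by (intro eqI) (simp add: vir.scale_right_diff_distrib)
    qed (auto simp: algebra_simps)
    show "v \<in> S \<longleftrightarrow> \<phi> v = 0" for v
      using \<phi>[of v] eqI[of v 0] by auto
    show "\<exists>v. \<phi> v \<noteq> 0"
      using eqI[of b 1] vir.subspace_0[OF S] by (intro exI[of _ b]) auto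
  qed
qed

section \<open>Geometric progressions over the integers and the spans with parameter
  \<open>c\<close>\<close>

lemma geometric_of_multiplicative:
  fixes a :: "int \<Rightarrow> complex"
  assumes a0: "a 0 \<noteq> 0" and mult: "\<And>j k. j \<noteq> k \<Longrightarrow> a 0 * a (j + k) = a j * a k"
  shows "a 1 \<noteq> 0" and "a 0 * a (j + 1) = a 1 * a j"
proof -
  have inv: "a 0 * a 0 = a 1 * a (-1)"
    using mult[of 1 "-1"] by simp
  then show a1: "a 1 \<noteq> 0" using a0 by auto
  show "a 0 * a (j + 1) = a 1 * a j"
  proof (cases "j = 1")
    case True
    \<comment> \<open>The relation is not assumed at j = k = 1. The value a_1^2 is reached instead
      through 1 = 2 + (-1), combined with a_0^2 = a_1 a_(-1).\<close>
    have "a 0 * a 1 = a 2 * a (-1)" using mult[of 2 "-1"] by simp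
    then have "a 0 * (a 0 * a 2) = a 0 * (a 1 * a 1)"
      using inv by algebra
    with True a0 show ?thesis by simp
  qed (use mult[of j 1] in simp)
qed

text \<open>Bounds the codimension of \<open>T\<close> by one. Modulo \<open>T\<close>, e_j equals
  -c e_(j+1); as \<open>c\<close> is invertible, induction in both directions from index 0 reduces
  every e_j to a multiple of e_0.\<close>

lemma span_gen_complement:
  assumes c: "c \<noteq> 0"
    and T: "T = vir.span ({vir_z} \<union> {vir_e j + c *\<^sub>V vir_e (j + 1) | j::int. True})"
  shows "\<exists>\<alpha>. x - \<alpha> *\<^sub>V vir_e 0 \<in> T"
proof -
  have subT: "vir.subspace T" by (simp add: T)
  have sub: "vir.subspace {x. \<exists>\<alpha>. x - \<alpha> *\<^sub>V vir_e 0 \<in> T}"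
  proof (rule vir.subspaceI; clarsimp)
    show "\<exists>\<alpha>. - (\<alpha> *\<^sub>V vir_e 0) \<in> T"
      using vir.subspace_0[OF subT] by (intro exI[of _ 0]) simp
  next
    fix x y \<alpha> \<beta> assume "x - \<alpha> *\<^sub>V vir_e 0 \<in> T" "y - \<beta> *\<^sub>V vir_e 0 \<in> T"
    from vir.subspace_add[OF subT this] show "\<exists>\<alpha>. x + y - \<alpha> *\<^sub>V vir_e 0 \<in> T"
      by (intro exI[of _ "\<alpha> + \<beta>"]) (simp add: vir.scale_left_distrib algebra_simps)
  next
    fix x \<alpha> d assume "x - \<alpha> *\<^sub>V vir_e 0 \<in> T"
    from vir.subspace_scale[OF subT this, of d] show "\<exists>\<alpha>. d *\<^sub>V x - \<alpha> *\<^sub>V vir_e 0 \<in> T"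
      by (intro exI[of _ "d * \<alpha>"]) (simp add: vir.scale_right_diff_distrib)
  qed
  have f: "vir_e j + c *\<^sub>V vir_e (j + 1) \<in> {x. \<exists>\<alpha>. x - \<alpha> *\<^sub>V vir_e 0 \<in> T}" for j
    unfolding mem_Collect_eq T by (intro exI[of _ 0]) (auto intro: vir.span_base)
  have "vir_e j \<in> {x. \<exists>\<alpha>. x - \<alpha> *\<^sub>V vir_e 0 \<in> T}" for j
  proof (induction j rule: int_induct[where k = 0])
    case base
    show ?case using vir.subspace_0[OF subT] by (auto intro: exI[of _ 1])
  next
    case (step1 j)
    have eq: "vir_e (j + 1) = (1 / c) *\<^sub>V ((vir_e j + c *\<^sub>V vir_e (j + 1)) - vir_e j)"
      using c by simp
    show ?case
      by (subst eq) (intro vir.subspace_scale[OF sub] vir.subspace_diff[OF sub] f step1.IH)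
  next
    case (step2 j)
    have eq: "vir_e (j - 1) = (vir_e (j - 1) + c *\<^sub>V vir_e (j - 1 + 1)) - c *\<^sub>V vir_e j"
      by simp
    show ?case
      by (subst eq) (intro vir.subspace_scale[OF sub] vir.subspace_diff[OF sub] f step2.IH)
  qed
  moreover have "vir_z \<in> {x. \<exists>\<alpha>. x - \<alpha> *\<^sub>V vir_e 0 \<in> T}"
    unfolding mem_Collect_eq T by (intro exI[of _ 0]) (auto intro: vir.span_base)
  ultimately have "vir.span ({vir_z} \<union> range vir_e) \<subseteq> {x. \<exists>\<alpha>. x - \<alpha> *\<^sub>V vir_e 0 \<in> T}"
    by (intro vir.span_minimal sub) auto
  then show ?thesis unfolding vir_span_basis by blast
qed

text \<open>For f_j = e_j + c e_(j+1) the mixed coefficients (k + 1 - j) and (k - j - 1) add up to 2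
  (k - j), so [f_j, f_k] = (k - j) (f_(j+k) + c f_(j+k+1)) modulo z, and z lies in the span.\<close>

lemma lie_subalgebra_span_gen:
  "lie_subalgebra (vir.span ({vir_z} \<union> {vir_e j + c *\<^sub>V vir_e (j + 1) | j::int. True}))"
    (is "lie_subalgebra (vir.span ?G)")
proof -
  have "vir_bracket x y \<in> vir.span ?G" if "x \<in> ?G" "y \<in> ?G" for x y
  proof -
    define f where "f j = vir_e j + c *\<^sub>V vir_e (j + 1)" for j
    have f: "f j \<in> vir.span ?G" for j
      unfolding f_def by (auto intro: vir.span_base)
    have z: "vir_z \<in> vir.span ?G" by (auto intro: vir.span_base)
    have "vir_bracket (f j) (f k) \<in> vir.span ?G" for j k
    proof -
      \<comment> \<open>\<open>d\<close> hides the case distinction of the cocycle, so that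
        comparing coefficients treats the central terms as opaque constants.\<close>
      define d where "d m n = (if n = - m then of_int (m ^ 3 - m) / 12 else 0 :: complex)"
        for m n :: int
      have ee: "vir_bracket (vir_e m) (vir_e n) = of_int (n - m) *\<^sub>V vir_e (m + n) + d m n *\<^sub>V vir_z"
        for m n
        by (simp add: vir_bracket_e_e d_def)
      have "vir_bracket (f j) (f k) = of_int (k - j) *\<^sub>V f (j + k) + (c * of_int (k - j)) *\<^sub>V f (j + k + 1)
          + (d j k + c * d j (k + 1) + c * d (j + 1) k + c * c * d (j + 1) (k + 1)) *\<^sub>V vir_z"
        by (rule poly_mapping_eqI)
          (simp add: f_def vir_bracket_add_left vir_bracket_add_right vir_bracket_scale_left
            vir_bracket_scale_right ee lookup_add algebra_simps)
      then show ?thesis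
        by (simp only: f z vir.span_add vir.span_scale)
    qed
    with that show ?thesis
      by (auto simp: vir_bracket_z_left vir_bracket_z_right vir.span_zero f_def)
  qed
  then show ?thesis
    unfolding lie_subalgebra_def by (auto intro: vir_bracket_span_closed)
qed

section \<open>Functionals whose kernel is a subalgebra\<close>

locale kernel_subalgebra = Vector_Spaces.linear vir_scale "(*) :: complex \<Rightarrow> _" \<phi> for \<phi> +
  assumes closed: "\<phi> x = 0 \<Longrightarrow> \<phi> y = 0 \<Longrightarrow> \<phi> (vir_bracket x y) = 0"
    and nonzero: "\<exists>v. \<phi> v \<noteq> 0"
begin

lemma nonzero_basis: "\<phi> vir_z \<noteq> 0 \<or> (\<exists>j. \<phi> (vir_e j) \<noteq> 0)"
proof (rule ccontr)
  assume "\<not> ?thesis"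
  then have "\<phi> v = 0" if "v \<in> {vir_z} \<union> range vir_e" for v
    using that by auto
  then have "\<phi> v = 0" for v
    using eq_0_on_span[of "{vir_z} \<union> range vir_e" v] unfolding vir_span_basis by blast
  with nonzero show False by blast
qed

text \<open>Subtracting multiples of \<open>w\<close> moves \<open>x\<close> and \<open>y\<close>
  into the kernel: \<phi>(w) x - \<phi>(x) w and \<phi>(w) y - \<phi>(y) w. Expanding the bracket of
  these two and cancelling one factor \<phi>(w) gives the identity.\<close>

lemma bracket_identity:
  assumes w: "\<phi> w \<noteq> 0"
  shows "\<phi> w * \<phi> (vir_bracket x y) = \<phi> y * \<phi> (vir_bracket x w) + \<phi> x * \<phi> (vir_bracket w y)"
proof -
  have "\<phi> (vir_bracket (\<phi> w *\<^sub>V x + (- \<phi> x) *\<^sub>V w) (\<phi> w *\<^sub>V y + (- \<phi> y) *\<^sub>V w)) = 0"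
    by (rule closed) (simp_all only: add scale, simp_all)
  then have "\<phi> w * (\<phi> w * \<phi> (vir_bracket x y))
      = \<phi> w * (\<phi> y * \<phi> (vir_bracket x w) + \<phi> x * \<phi> (vir_bracket w y))"
    unfolding vir_bracket_add_left vir_bracket_add_right vir_bracket_scale_left
      vir_bracket_scale_right vir_bracket_self add scale zero by algebra
  with w show ?thesis by simp
qed

lemma phi_z: "\<phi> vir_z = 0"
proof (rule ccontr)
  assume z: "\<phi> vir_z \<noteq> 0"
  have br: "\<phi> (vir_bracket x y) = 0" for x y
    using bracket_identity[OF z, of x y] z
    by (simp add: vir_bracket_z_left vir_bracket_z_right zero)
  \<comment> \<open>[e_1, e_(-1)] = -2 e_0 has no central term, as 1^3 - 1 = 0. Then [e_2, e_(-2)] =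
    -4 e_0 + z/2 isolates z.\<close>
  have "\<phi> (vir_e 0) = 0"
    using br[of "vir_e 1" "vir_e (-1)"] by (simp add: vir_bracket_e_e scale neg)
  with z show False
    using br[of "vir_e 2" "vir_e (-2)"] by (simp add: vir_bracket_e_e add diff scale neg)
qed

text \<open>Since \<phi> kills z, it no longer sees the cocycle.\<close>

lemma phi_bracket_e:
  "\<phi> (vir_bracket (vir_e j) (vir_e k)) = of_int (k - j) * \<phi> (vir_e (j + k))"
  by (simp only: vir_bracket_e_e add scale) (simp add: scale phi_z zero)

lemma phi_e_0: "\<phi> (vir_e 0) \<noteq> 0"
proof
  assume 0: "\<phi> (vir_e 0) = 0"
  obtain m where m: "\<phi> (vir_e m) \<noteq> 0"
    using nonzero_basis phi_z by blast
  then have "m \<noteq> 0" using 0 by auto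
  \<comment> \<open>As e_0 acts on e_k by k and on e_m by m, and a_0 = 0, the identity reads k a_m
    a_k = m a_m a_k.\<close>
  have only: "\<phi> (vir_e k) = 0" if "k \<noteq> m" for k
    using bracket_identity[OF m, of "vir_e 0" "vir_e k"] m that 0
    by (simp add: phi_bracket_e)
  \<comment> \<open>The indices 2m and -m sum to m but both differ from it, so the right side of the
    identity vanishes.\<close>
  have "\<phi> (vir_e m) * (of_int (- m - 2 * m) * \<phi> (vir_e m)) = 0"
    using bracket_identity[OF m, of "vir_e (2 * m)" "vir_e (- m)"] only[of "2 * m"] only[of "- m"] \<open>m \<noteq> 0\<close>
    by (simp add: phi_bracket_e)
  then show False using m \<open>m \<noteq> 0\<close> by simp
qed

lemma phi_e_mult:
  assumes "j \<noteq> k"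
  shows "\<phi> (vir_e 0) * \<phi> (vir_e (j + k)) = \<phi> (vir_e j) * \<phi> (vir_e k)"
proof -
  \<comment> \<open>With w = e_0 the two terms on the right are -j a_j a_k and k a_j a_k.\<close>
  have "of_int (k - j) * (\<phi> (vir_e 0) * \<phi> (vir_e (j + k))) = of_int (k - j) * (\<phi> (vir_e j) * \<phi> (vir_e k))"
    using bracket_identity[OF phi_e_0, of "vir_e j" "vir_e k"]
    unfolding phi_bracket_e add_0_right add_0_left of_int_diff of_int_0 by algebra
  moreover have "of_int (k - j) \<noteq> (0 :: complex)"
    using assms by (simp only: of_int_eq_0_iff)
  ultimately show ?thesis by (rule mult_left_cancel[THEN iffD1, rotated])
qed

lemma kernel_eq_span:
  obtains c where "c \<noteq> 0"
    and "{v. \<phi> v = 0} = vir.span ({vir_z} \<union> {vir_e j + c *\<^sub>V vir_e (j + 1) | j::int. True})"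
proof
  define a where "a j = \<phi> (vir_e j)" for j
  note geom = geometric_of_multiplicative[of a, unfolded a_def, OF phi_e_0 phi_e_mult]
  \<comment> \<open>Minus the inverse ratio of the progression: exactly the value with a_j + c
    a_(j+1) = 0.\<close>
  define c where "c = - \<phi> (vir_e 0) / \<phi> (vir_e 1)"
  show c: "c \<noteq> 0" using phi_e_0 geom(1) by (simp add: c_def)
  let ?T = "vir.span ({vir_z} \<union> {vir_e j + c *\<^sub>V vir_e (j + 1) | j::int. True})"
  have "\<phi> (vir_e j + c *\<^sub>V vir_e (j + 1)) = 0" for j
    using geom(1) geom(2)[of j] by (simp add: add diff scale c_def field_simps)
  then have T: "\<phi> v = 0" if "v \<in> ?T" for v
    using that by (intro eq_0_on_span[OF _ that]) (auto simp: phi_z)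
  have "v \<in> ?T" if "\<phi> v = 0" for v
  proof -
    \<comment> \<open>Applying \<phi>, which vanishes on \<open>?T\<close> and at \<open>v\<close>,
      leaves \<alpha> a_0 = 0, hence \<alpha> = 0.\<close>
    obtain \<alpha> where \<alpha>: "v - \<alpha> *\<^sub>V vir_e 0 \<in> ?T"
      using span_gen_complement[OF c refl] by blast
    from T[OF this] that phi_e_0 have "\<alpha> = 0" by (simp add: diff scale)
    with \<alpha> show ?thesis by simp
  qed
  with T show "{v. \<phi> v = 0} = ?T" by blast
qed

end

theorem proposition2p3:
  fixes S :: "vir set"
  assumes "vir.subspace S" and "has_codim S 1"
  shows "lie_subalgebra S \<longleftrightarrow>
    (\<exists>c::complex. c \<noteq> 0 \<and>
       S = vir.span ({vir_z} \<union> {vir_e j + c *\<^sub>V vir_e (j + 1) | j::int. True}))"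
proof
  assume L: "lie_subalgebra S"
  obtain \<phi> where lin: "Vector_Spaces.linear vir_scale ((*) :: complex \<Rightarrow> _) \<phi>"
    and ker: "\<And>v. v \<in> S \<longleftrightarrow> \<phi> v = 0" and nz: "\<exists>v. \<phi> v \<noteq> 0"
    using functional_of_codim_1[OF assms(2)] by blast
  interpret kernel_subalgebra \<phi>
    using lin nz L by (auto simp: kernel_subalgebra_def kernel_subalgebra_axioms_def lie_subalgebra_def ker)
  have S: "S = {v. \<phi> v = 0}" using ker by blast
  show "\<exists>c::complex. c \<noteq> 0 \<and>
      S = vir.span ({vir_z} \<union> {vir_e j + c *\<^sub>V vir_e (j + 1) | j::int. True})"
    unfolding S by (rule kernel_eq_span) (intro exI conjI)
next
  assume "\<exists>c::complex. c \<noteq> 0 \<and>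
      S = vir.span ({vir_z} \<union> {vir_e j + c *\<^sub>V vir_e (j + 1) | j::int. True})"
  then show "lie_subalgebra S"
    by (elim exE conjE) (simp only: lie_subalgebra_span_gen)
qed

end
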